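(* Let $\Lambda$ be a partially ordered set. The (MacNeille) closed lower sets of $\Lambda^{*}$ form a well-founded lattice (under inclusion) whose members are exactly $\Lambda^{*}$ and all nonempty finitely generated lower sets of $\Lambda^{*}$ if and only if $\Lambda$ is well-founded and every compatible pair of incomparable letters $\alpha,\beta\in\Lambda$ has a common upper bound in $\Lambda$ and the set of common lower bounds of $\alpha$ and $\beta$ in $\Lambda$ is a finitely generated lower set of $\Lambda$. In particular, this holds for the ordered set $\Lambda$ obtained from a disjoint union of well-founded lattices by removing the antichain of their minimal elements.
   Context: $\Lambda^{*}$ is the set of finite words over $\Lambda$ including the empty word, ordered by: $\alpha_1\cdots\alpha_m\le\beta_1\cdots\beta_n$ iff there are $1\le i_1<\dots<i_m\le n$ with $\alpha_j\le\beta_{i_j}$ for all $j$. Lower sets, $\downarrow X=\{w: w\le x\text{ for some }x\in X\}$, finitely generated = $\downarrow X$ with $X$ finite (in $\Lambda^*$ or in $\Lambda$ accordingly). $X^{\Delta}=\{y: x\le y\ \forall x\in X\}$, $X^{\nabla}=\{w: w\le x\ \forall x\in X\}$ (with $\emptyset^\Delta=\emptyset^\nabla=\Lambda^*$); a lower set $W$ is closed if $W=(W^{\Delta})^{\nabla}$. Two letters are compatible if they have a common lower bound in $\Lambda$. Well-founded: no infinite strictly decreasing sequence. *)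

theory Defs
  imports "HOL-Algebra.Lattice" "HOL-Library.Sublist"
begin

text \<open>Ordered sets are order records in the sense of \<open>HOL-Algebra\<close>, with explicit carrier.
  The library operators \<^const>\<open>Upper\<close> and \<^const>\<open>Lower\<close> are the maps
  \<open>X \<mapsto> X\<^sup>\<Delta>\<close> and \<open>X \<mapsto> X\<^sup>\<nabla>\<close>; both send the empty set to the carrier.\<close>

definition words :: "'a gorder \<Rightarrow> 'a list gorder" where
  "words \<Lambda> = \<lparr>carrier = lists (carrier \<Lambda>), eq = (=), le = list_emb (le \<Lambda>)\<rparr>"

text \<open>The library embedding \<^const>\<open>list_emb\<close> is the subword order in terms of
  increasing sequences of positions.\<close>

lemma list_emb_iff_positions:
  "list_emb P u v \<longleftrightarrow>
    (\<exists>f. strict_mono_on {..<length u} f \<and>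
         (\<forall>j<length u. f j < length v \<and> P (u ! j) (v ! f j)))"
proof
  assume "list_emb P u v"
  then show "\<exists>f. strict_mono_on {..<length u} f \<and>
         (\<forall>j<length u. f j < length v \<and> P (u ! j) (v ! f j))"
  proof induction
    case (list_emb_Nil ys)
    then show ?case by (auto simp: monotone_on_def)
  next
    case (list_emb_Cons xs ys y)
    then obtain f where "strict_mono_on {..<length xs} f"
      "\<forall>j<length xs. f j < length ys \<and> P (xs ! j) (ys ! f j)" by blast
    then show ?case
      by (intro exI[of _ "\<lambda>j. Suc (f j)"]) (auto simp: monotone_on_def)
  next
    case (list_emb_Cons2 x y xs ys)
    then obtain f where "strict_mono_on {..<length xs} f"
      "\<forall>j<length xs. f j < length ys \<and> P (xs ! j) (ys ! f j)" by blast
    then show ?case using \<open>P x y\<close>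
      by (intro exI[of _ "case_nat 0 (\<lambda>j. Suc (f j))"])
        (auto simp: monotone_on_def nth_Cons split: nat.splits)
  qed
next
  assume "\<exists>f. strict_mono_on {..<length u} f \<and>
         (\<forall>j<length u. f j < length v \<and> P (u ! j) (v ! f j))"
  then obtain f where "strict_mono_on {..<length u} f"
    "\<forall>j<length u. f j < length v \<and> P (u ! j) (v ! f j)" by blast
  then show "list_emb P u v"
  proof (induction v arbitrary: u f)
    case Nil
    then show ?case by (cases u) auto
  next
    case (Cons y ys)
    note mono = Cons.prems(1) and emb = Cons.prems(2)
    show ?case
    proof (cases u)
      case Nil
      then show ?thesis by simp
    next
      case (Cons x xs)
      have lt: "f i < f j" if "i < j" "j < length u" for i j
        using mono that by (auto simp: monotone_on_def)
      show ?thesis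
      proof (cases "f 0 = 0")
        case True
        have pos: "f (Suc j) > 0" if "j < length xs" for j
          using lt[of 0 "Suc j"] that Cons by simp
        have "list_emb P xs ys"
        proof (rule Cons.IH[of _ "\<lambda>j. f (Suc j) - 1"])
          show "strict_mono_on {..<length xs} (\<lambda>j. f (Suc j) - 1)"
            using lt pos Cons by (auto simp: monotone_on_def intro!: diff_less_mono Suc_leI)
          show "\<forall>j<length xs. f (Suc j) - 1 < length ys \<and> P (xs ! j) (ys ! (f (Suc j) - 1))"
          proof (intro allI impI)
            fix j assume j: "j < length xs"
            then show "f (Suc j) - 1 < length ys \<and> P (xs ! j) (ys ! (f (Suc j) - 1))"
              using emb[rule_format, of "Suc j"] pos[OF j] Cons by (auto simp: nth_Cons')
          qed
        qed
        moreover have "P x y" using emb[rule_format, of 0] True Cons by simp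
        ultimately show ?thesis using Cons by auto
      next
        case False
        have pos: "f j > 0" if "j < length u" for j
          using lt[of 0 j] that False by (cases j) auto
        have "list_emb P u ys"
        proof (rule Cons.IH[of _ "\<lambda>j. f j - 1"])
          show "strict_mono_on {..<length u} (\<lambda>j. f j - 1)"
            using lt pos by (auto simp: monotone_on_def intro!: diff_less_mono Suc_leI)
          show "\<forall>j<length u. f j - 1 < length ys \<and> P (u ! j) (ys ! (f j - 1))"
          proof (intro allI impI)
            fix j assume j: "j < length u"
            then show "f j - 1 < length ys \<and> P (u ! j) (ys ! (f j - 1))"
              using emb[rule_format, of j] pos[OF j] by (auto simp: nth_Cons')
          qed
        qed
        then show ?thesis by auto
      qed
    qed
  qed
qed

definition well_founded :: "'a gorder \<Rightarrow> bool" where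
  "well_founded P \<longleftrightarrow>
    \<not> (\<exists>f :: nat \<Rightarrow> 'a. \<forall>n. f n \<in> carrier P \<and> f (Suc n) \<sqsubset>\<^bsub>P\<^esub> f n)"

definition lower_set :: "'a gorder \<Rightarrow> 'a set \<Rightarrow> bool" where
  "lower_set P W \<longleftrightarrow>
    W \<subseteq> carrier P \<and> (\<forall>x\<in>W. \<forall>w\<in>carrier P. w \<sqsubseteq>\<^bsub>P\<^esub> x \<longrightarrow> w \<in> W)"

definition down :: "'a gorder \<Rightarrow> 'a set \<Rightarrow> 'a set" where
  "down P X = {w \<in> carrier P. \<exists>x\<in>X. w \<sqsubseteq>\<^bsub>P\<^esub> x}"

definition fin_gen_lower_set :: "'a gorder \<Rightarrow> 'a set \<Rightarrow> bool" where
  "fin_gen_lower_set P W \<longleftrightarrow> (\<exists>X \<subseteq> carrier P. finite X \<and> W = down P X)"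

definition closed_lower_set :: "'a gorder \<Rightarrow> 'a set \<Rightarrow> bool" where
  "closed_lower_set P W \<longleftrightarrow> lower_set P W \<and> W = Lower P (Upper P W)"

definition closed_lower_sets :: "'a gorder \<Rightarrow> 'a set gorder" where
  "closed_lower_sets P = \<lparr>carrier = {W. closed_lower_set P W}, eq = (=), le = (\<subseteq>)\<rparr>"

definition closed_sets_are_wf_lattice_of_fin_gen :: "'a gorder \<Rightarrow> bool" where
  "closed_sets_are_wf_lattice_of_fin_gen P \<longleftrightarrow>
    Lattice.lattice (closed_lower_sets P) \<and>
    well_founded (closed_lower_sets P) \<and>
    carrier (closed_lower_sets P) =
      {carrier P} \<union> {W. fin_gen_lower_set P W \<and> W \<noteq> {}}"

definition compatible :: "'a gorder \<Rightarrow> 'a \<Rightarrow> 'a \<Rightarrow> bool" where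
  "compatible P a b \<longleftrightarrow> (\<exists>c\<in>carrier P. c \<sqsubseteq>\<^bsub>P\<^esub> a \<and> c \<sqsubseteq>\<^bsub>P\<^esub> b)"

definition incomparable :: "'a gorder \<Rightarrow> 'a \<Rightarrow> 'a \<Rightarrow> bool" where
  "incomparable P a b \<longleftrightarrow> \<not> a \<sqsubseteq>\<^bsub>P\<^esub> b \<and> \<not> b \<sqsubseteq>\<^bsub>P\<^esub> a"

definition disjoint_union :: "'i set \<Rightarrow> ('i \<Rightarrow> 'a gorder) \<Rightarrow> ('i \<times> 'a) gorder" where
  "disjoint_union I L =
    \<lparr>carrier = (SIGMA i:I. carrier (L i)), eq = (=),
     le = (\<lambda>(i, x) (j, y). i = j \<and> x \<sqsubseteq>\<^bsub>L i\<^esub> y)\<rparr>"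

definition minimal_elements :: "'a gorder \<Rightarrow> 'a set" where
  "minimal_elements P = {x \<in> carrier P. \<not> (\<exists>y\<in>carrier P. y \<sqsubset>\<^bsub>P\<^esub> x)}"

definition remove_minimal :: "'a gorder \<Rightarrow> 'a gorder" where
  "remove_minimal P = P\<lparr>carrier := carrier P - minimal_elements P\<rparr>"

end

theory Submission
  imports Defs "HOL-Library.Multiset"
begin

text \<open>A nonempty finitely generated lower set \<open>\<down>X\<close> is closed as soon as every word \<open>w\<close> that
  lies below neither \<open>x\<close> nor \<open>y\<close> fails to lie below some common upper bound of \<open>x\<close> and \<open>y\<close>.
  For words, such a bound is obtained by merging \<open>x\<close> and \<open>y\<close> greedily: letters of \<open>x\<close> and \<open>y\<close>
  that are not above the first letter \<open>c\<close> of \<open>w\<close> are copied, and once both words start with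
  letters above \<open>c\<close>, these are compatible and get replaced by a common upper bound.
  Conversely, an intersection of principal ideals is finitely generated because finitely
  generated lower sets of a well-founded order satisfy the descending chain condition, by
  comparing their sets of maximal elements in the multiset order. Necessity of the conditions is
  read off from the closed sets \<open>\<down>{\<alpha>, \<beta>}\<close> and \<open>\<down>\<alpha> \<inter> \<down>\<beta>\<close>: if \<open>\<gamma> \<le> \<alpha>, \<beta>\<close> and
  \<open>\<alpha>, \<beta>\<close> have no common upper bound in the alphabet, then \<open>\<gamma>\<gamma>\<close> is below all upper bounds
  of \<open>{\<alpha>, \<beta>}\<close>, without being below \<open>\<alpha>\<close> or \<open>\<beta>\<close>.\<close>

section \<open>Closed and finitely generated lower sets\<close>

text \<open>Restricting the strict order to the carrier makes \<open>wf\<close> of this relation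
  agree with \<open>well_founded\<close>, which only considers sequences in the carrier, and lets
  \<open>mult\<close> be applied to it.\<close>

definition strict_rel :: "'a gorder \<Rightarrow> ('a \<times> 'a) set" where
  "strict_rel P = {(x, y). x \<in> carrier P \<and> y \<in> carrier P \<and> x \<sqsubset>\<^bsub>P\<^esub> y}"

lemma well_founded_iff_wf: "well_founded P \<longleftrightarrow> wf (strict_rel P)"
  unfolding well_founded_def wf_iff_no_infinite_down_chain strict_rel_def by auto

lemma trans_strict_rel: "partial_order P \<Longrightarrow> trans (strict_rel P)"
  unfolding strict_rel_def trans_def
  by (auto intro: weak_partial_order.lless_trans[OF partial_order.axioms(1)])

lemma lless_iff: "partial_order P \<Longrightarrow> x \<sqsubset>\<^bsub>P\<^esub> y \<longleftrightarrow> x \<sqsubseteq>\<^bsub>P\<^esub> y \<and> x \<noteq> y"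
  by (simp add: lless_def partial_order.eq_is_equal)

section \<open>The Galois closure and the lattice of closed lower sets\<close>

lemma lower_set_Lower:
  assumes "partial_order P" shows "lower_set P (Lower P X)"
proof -
  interpret partial_order P by fact
  show ?thesis unfolding lower_set_def Lower_def by (auto intro: le_trans)
qed

lemma subset_Lower_Upper: "W \<subseteq> carrier P \<Longrightarrow> W \<subseteq> Lower P (Upper P W)"
  unfolding Lower_def Upper_def by auto

text \<open>Every element of \<open>X\<close> bounds \<open>Lower P X\<close> from above, so the
  double polar of \<open>Lower P X\<close> is contained in \<open>Lower P X\<close>. This is the
  only source of closed sets below, apart from finitely generated ones and the whole
  carrier.\<close>

lemma closed_lower_set_Lower:
  assumes "partial_order P" and "X \<subseteq> carrier P" shows "closed_lower_set P (Lower P X)"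
proof -
  have "X \<subseteq> Upper P (Lower P X)"
    using assms(2) by (auto simp: Lower_def Upper_def)
  then have "Lower P (Upper P (Lower P X)) \<subseteq> Lower P X"
    by (auto simp: Lower_def)
  then show ?thesis
    unfolding closed_lower_set_def
    using lower_set_Lower[OF assms(1)] subset_Lower_Upper[of "Lower P X" P] by blast
qed

lemma lattice_closed_lower_sets:
  assumes "partial_order P" shows "Lattice.lattice (closed_lower_sets P)"
proof -
  have cl: "closed_lower_set P W \<Longrightarrow> W = Lower P (Upper P W)" for W
    by (simp add: closed_lower_set_def)
  have Lower_Un: "Lower P (X \<union> Y) = Lower P X \<inter> Lower P Y" for X Y
    by (auto simp: Lower_def)
  interpret partial_order "closed_lower_sets P"
    by unfold_locales (auto simp: closed_lower_sets_def)
  show ?thesis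
  proof unfold_locales
    fix V W assume "V \<in> carrier (closed_lower_sets P)" "W \<in> carrier (closed_lower_sets P)"
    then have V: "closed_lower_set P V" and W: "closed_lower_set P W"
      by (auto simp: closed_lower_sets_def)
    have sub: "V \<union> W \<subseteq> carrier P"
      using V W by (auto simp: closed_lower_set_def lower_set_def)
    \<comment> \<open>The join is the closure of the union; it lies in every closed \<open>Z\<close>
      above both sets because closure is monotone.\<close>
    let ?J = "Lower P (Upper P (V \<union> W))"
    have J: "closed_lower_set P ?J"
      using assms by (auto intro: closed_lower_set_Lower simp: Upper_def)
    have "?J \<subseteq> Z" if "V \<union> W \<subseteq> Z" and Z: "closed_lower_set P Z" for Z
    proof -
      have "?J \<subseteq> Lower P (Upper P Z)" using that(1) by (auto simp: Lower_def Upper_def)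
      then show ?thesis using cl[OF Z] by simp
    qed
    then have "least (closed_lower_sets P) ?J (Upper (closed_lower_sets P) {V, W})"
      using J V W subset_Lower_Upper[OF sub]
      unfolding least_def closed_lower_sets_def
      by (auto simp: Upper_def[of "\<lparr>carrier = {W. closed_lower_set P W}, eq = (=), le = (\<subseteq>)\<rparr>"])
    then show "\<exists>s. least (closed_lower_sets P) s (Upper (closed_lower_sets P) {V, W})" ..
    \<comment> \<open>Writing the intersection as the lower polar of a union of two upper polars
      shows that it is closed, hence the meet.\<close>
    have "V \<inter> W = Lower P (Upper P V \<union> Upper P W)"
      using cl[OF V] cl[OF W] Lower_Un by metis
    then have "closed_lower_set P (V \<inter> W)"
      using closed_lower_set_Lower[OF assms, of "Upper P V \<union> Upper P W"] by (simp add: Upper_def)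
    then have "greatest (closed_lower_sets P) (V \<inter> W) (Lower (closed_lower_sets P) {V, W})"
      using V W unfolding greatest_def closed_lower_sets_def
      by (auto simp: Lower_def[of "\<lparr>carrier = {W. closed_lower_set P W}, eq = (=), le = (\<subseteq>)\<rparr>"])
    then show "\<exists>s. greatest (closed_lower_sets P) s (Lower (closed_lower_sets P) {V, W})" ..
  qed
qed

section \<open>Finitely generated lower sets and their descending chain condition\<close>

lemma lower_set_down:
  assumes "partial_order P" "X \<subseteq> carrier P" shows "lower_set P (down P X)"
proof -
  interpret partial_order P by fact
  show ?thesis using assms(2) unfolding lower_set_def down_def by (blast intro: le_trans)
qed

lemma fin_gen_lower_setI:
  "finite X \<Longrightarrow> X \<subseteq> carrier P \<Longrightarrow> W = down P X \<Longrightarrow> fin_gen_lower_set P W"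
  unfolding fin_gen_lower_set_def by blast

lemma fin_gen_lower_set_Un:
  assumes "fin_gen_lower_set P V" "fin_gen_lower_set P W"
  shows "fin_gen_lower_set P (V \<union> W)"
proof -
  obtain X Y where "X \<subseteq> carrier P" "finite X" "V = down P X"
    "Y \<subseteq> carrier P" "finite Y" "W = down P Y"
    using assms by (auto simp: fin_gen_lower_set_def)
  then show ?thesis
    by (intro fin_gen_lower_setI[of "X \<union> Y"]) (auto simp: down_def)
qed

lemma fin_gen_lower_set_empty: "fin_gen_lower_set P {}"
  by (rule fin_gen_lower_setI[of "{}"]) (auto simp: down_def)

lemma fin_gen_lower_set_UNION:
  "finite A \<Longrightarrow> (\<And>a. a \<in> A \<Longrightarrow> fin_gen_lower_set P (f a)) \<Longrightarrow> fin_gen_lower_set P (\<Union>a\<in>A. f a)"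
  by (induction A rule: finite_induct)
    (auto intro: fin_gen_lower_set_Un fin_gen_lower_set_empty)

definition maximals :: "'a gorder \<Rightarrow> 'a set \<Rightarrow> 'a set" where
  "maximals P W = {x \<in> W. \<forall>y\<in>W. x \<sqsubseteq>\<^bsub>P\<^esub> y \<longrightarrow> y = x}"

text \<open>Maximal elements occur in every generating set, so they are finite in number.
  Conversely, each element lies below a generator, and finiteness of the generating set provides a
  maximal generator above that one.\<close>

lemma fin_gen_maximals:
  assumes P: "partial_order P" and W: "fin_gen_lower_set P W"
  shows "finite (maximals P W)" and "x \<in> W \<Longrightarrow> \<exists>m\<in>maximals P W. x \<sqsubseteq>\<^bsub>P\<^esub> m"
proof -
  interpret partial_order P by fact
  obtain X where X: "X \<subseteq> carrier P" "finite X" "W = down P X"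
    using W by (auto simp: fin_gen_lower_set_def)
  then have XW: "X \<subseteq> W" by (force simp: down_def)
  have "maximals P W \<subseteq> X"
    using XW X by (auto simp: maximals_def down_def)
  then show "finite (maximals P W)" using X(2) finite_subset by blast
  assume "x \<in> W"
  then obtain z where z: "z \<in> X" "x \<sqsubseteq>\<^bsub>P\<^esub> z" "x \<in> carrier P" using X(3) by (auto simp: down_def)
  \<comment> \<open>A maximal element of \<open>?A\<close> is maximal in all of \<open>W\<close>,
    because every element of \<open>W\<close> above it lies below a generator that again belongs to
    \<open>?A\<close>.\<close>
  let ?A = "{y \<in> X. z \<sqsubseteq>\<^bsub>P\<^esub> y}"
  have "\<exists>m\<in>?A. \<forall>y\<in>?A. y \<noteq> m \<longrightarrow> \<not> m \<sqsubset>\<^bsub>P\<^esub> y"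
  proof (rule Finite_Set.bex_max_element)
    show "finite ?A" using X(2) by simp
    show "asymp_on ?A (\<lambda>x y. x \<sqsubset>\<^bsub>P\<^esub> y)"
      using X(1) by (intro asymp_onI) (auto simp: lless_iff[OF P] dest: le_antisym)
    show "transp_on ?A (\<lambda>x y. x \<sqsubset>\<^bsub>P\<^esub> y)"
    proof (rule transp_onI)
      fix u v w assume "u \<in> ?A" "v \<in> ?A" "w \<in> ?A" "u \<sqsubset>\<^bsub>P\<^esub> v" "v \<sqsubset>\<^bsub>P\<^esub> w"
      then show "u \<sqsubset>\<^bsub>P\<^esub> w" using X(1) lless_trans[of u v w] by auto
    qed
    have "z \<in> ?A" using z X(1) by auto
    then show "?A \<noteq> {}" by blast
  qed
  then obtain m where m: "m \<in> X" "z \<sqsubseteq>\<^bsub>P\<^esub> m"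
    and max: "\<And>y. y \<in> X \<Longrightarrow> z \<sqsubseteq>\<^bsub>P\<^esub> y \<Longrightarrow> y \<noteq> m \<Longrightarrow> \<not> m \<sqsubseteq>\<^bsub>P\<^esub> y"
    by (auto simp: lless_iff[OF P])
  have "y = m" if y: "y \<in> W" "m \<sqsubseteq>\<^bsub>P\<^esub> y" for y
  proof -
    obtain v where v: "v \<in> X" "y \<sqsubseteq>\<^bsub>P\<^esub> v" "y \<in> carrier P"
      using y(1) X(3) by (auto simp: down_def)
    have mc: "m \<in> carrier P" "v \<in> carrier P" "z \<in> carrier P" using m v z X(1) by auto
    then have mv: "m \<sqsubseteq>\<^bsub>P\<^esub> v" using that(2) v le_trans by blast
    then have "z \<sqsubseteq>\<^bsub>P\<^esub> v" using m mc le_trans by blast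
    then have "v = m" using max[OF v(1)] mv by blast
    then show ?thesis using v that(2) mc le_antisym by blast
  qed
  then have "m \<in> maximals P W" using m XW by (auto simp: maximals_def)
  moreover have "x \<sqsubseteq>\<^bsub>P\<^esub> m" using z m X(1) le_trans[of x z m] by auto
  ultimately show "\<exists>m\<in>maximals P W. x \<sqsubseteq>\<^bsub>P\<^esub> m" by blast
qed

lemma wf_fin_gen_lower_sets:
  assumes P: "partial_order P" and wf: "well_founded P"
  shows "wf {(V, W). fin_gen_lower_set P V \<and> fin_gen_lower_set P W \<and> V \<subset> W}"
proof (rule wf_subset)
  let ?f = "\<lambda>W. mset_set (maximals P W)"
  show "wf (inv_image (mult (strict_rel P)) ?f)"
    using wf by (simp add: well_founded_iff_wf wf_mult)
  show "{(V, W). fin_gen_lower_set P V \<and> fin_gen_lower_set P W \<and> V \<subset> W}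
      \<subseteq> inv_image (mult (strict_rel P)) ?f"
  proof (rule subrelI)
    fix V W assume "(V, W) \<in> {(V, W). fin_gen_lower_set P V \<and> fin_gen_lower_set P W \<and> V \<subset> W}"
    then have V: "fin_gen_lower_set P V" and W: "fin_gen_lower_set P W" and VW: "V \<subset> W" by auto
    interpret partial_order P by fact
    let ?M = "maximals P V" and ?N = "maximals P W"
    have fin: "finite ?M" "finite ?N" using fin_gen_maximals(1)[OF P] V W by auto
    have Wc: "W \<subseteq> carrier P" using W by (auto simp: fin_gen_lower_set_def down_def)
    have low: "lower_set P V" using V lower_set_down[OF P] by (auto simp: fin_gen_lower_set_def)
    \<comment> \<open>If every maximal element of \<open>W\<close> belonged to the lower set
      \<open>V\<close>, then \<open>V\<close> would contain \<open>W\<close>.\<close>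
    have "?N - ?M \<noteq> {}"
    proof
      assume "?N - ?M = {}"
      then have "?N \<subseteq> V" by (auto simp: maximals_def)
      then have "W \<subseteq> V"
        using fin_gen_maximals(2)[OF P W] low Wc unfolding lower_set_def by blast
      with VW show False by blast
    qed
    \<comment> \<open>A maximal element of \<open>V\<close> that is no longer maximal in
      \<open>W\<close> has a maximal element of \<open>W\<close> strictly above it, and this one
      cannot lie in \<open>V\<close>.\<close>
    moreover have "\<exists>y\<in>?N - ?M. (x, y) \<in> strict_rel P" if x: "x \<in> ?M - ?N" for x
    proof -
      have "x \<in> W" using x VW by (auto simp: maximals_def)
      then obtain y where y: "y \<in> ?N" "x \<sqsubseteq>\<^bsub>P\<^esub> y" using fin_gen_maximals(2)[OF P W] by blast
      then have "x \<noteq> y" using x by auto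
      moreover from this have "y \<notin> ?M" using x y(2) by (auto simp: maximals_def)
      moreover have "y \<in> W" using y by (auto simp: maximals_def)
      ultimately show ?thesis
        using y \<open>x \<in> W\<close> Wc by (auto simp: strict_rel_def lless_iff[OF P])
    qed
    \<comment> \<open>One step of the multiset order: the common part stays, and the nonempty
      \<open>?N - ?M\<close> is replaced by the elements of \<open>?M - ?N\<close>, each strictly
      dominated.\<close>
    ultimately have "(mset_set (?M \<inter> ?N) + mset_set (?M - ?N),
        mset_set (?M \<inter> ?N) + mset_set (?N - ?M)) \<in> mult (strict_rel P)"
      using fin by (intro one_step_implies_mult) (auto simp: mset_set_empty_iff)
    moreover have "mset_set (?M \<inter> ?N) + mset_set (?M - ?N) = mset_set ?M"
      using fin by (subst mset_set_Union[symmetric]) (auto intro: arg_cong[of _ _ mset_set])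
    moreover have "mset_set (?M \<inter> ?N) + mset_set (?N - ?M) = mset_set ?N"
      using fin by (subst mset_set_Union[symmetric]) (auto intro: arg_cong[of _ _ mset_set])
    ultimately show "(V, W) \<in> inv_image (mult (strict_rel P)) ?f" by simp
  qed
qed

text \<open>Intersection distributes over the two finite unions of principal ideals, which leaves
  finitely many pairwise intersections.\<close>

lemma fin_gen_Int:
  assumes ideals: "\<And>x y. x \<in> carrier P \<Longrightarrow> y \<in> carrier P \<Longrightarrow> fin_gen_lower_set P (down P {x} \<inter> down P {y})"
    and V: "fin_gen_lower_set P V" and W: "fin_gen_lower_set P W"
  shows "fin_gen_lower_set P (V \<inter> W)"
proof -
  obtain X Y where "X \<subseteq> carrier P" "finite X" "V = down P X"
    "Y \<subseteq> carrier P" "finite Y" "W = down P Y"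
    using V W by (auto simp: fin_gen_lower_set_def)
  moreover from this have "V \<inter> W = (\<Union>x\<in>X. \<Union>y\<in>Y. down P {x} \<inter> down P {y})"
    by (auto simp: down_def)
  moreover from calculation have "fin_gen_lower_set P (\<Union>x\<in>X. \<Union>y\<in>Y. down P {x} \<inter> down P {y})"
    by (intro fin_gen_lower_set_UNION ideals) auto
  ultimately show ?thesis by simp
qed

text \<open>The descending chain condition reduces an arbitrary \<open>U\<close> to a finite
  nonempty subset with the same lower bounds. Nonemptiness matters since \<open>Lower P {}\<close>
  is the whole carrier, which may fail to be finitely generated.\<close>

lemma fin_gen_Lower:
  assumes P: "partial_order P" and wf: "well_founded P"
    and ideals: "\<And>x y. x \<in> carrier P \<Longrightarrow> y \<in> carrier P \<Longrightarrow> fin_gen_lower_set P (down P {x} \<inter> down P {y})"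
    and U: "U \<subseteq> carrier P" "U \<noteq> {}"
  shows "fin_gen_lower_set P (Lower P U)"
proof -
  have Lower_insert: "Lower P (insert x X) = down P {x} \<inter> Lower P X" if "x \<in> carrier P" for x X
    using that by (auto simp: Lower_def down_def)
  have ideal: "fin_gen_lower_set P (down P {x})" if "x \<in> carrier P" for x
    using that by (auto intro: fin_gen_lower_setI)
  have finite_case: "fin_gen_lower_set P (Lower P Y)" if "finite Y" "Y \<noteq> {}" "Y \<subseteq> carrier P" for Y
    using that
  proof (induction Y rule: finite_ne_induct)
    case (singleton x)
    then have "Lower P {x} = down P {x}" by (auto simp: Lower_def down_def)
    with singleton ideal show ?case by simp
  next
    case (insert x Y)
    then show ?case using ideal by (simp add: Lower_insert fin_gen_Int[OF ideals])
  qed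
  let ?F = "{Lower P Y |Y. finite Y \<and> Y \<noteq> {} \<and> Y \<subseteq> U}"
  obtain u where u: "u \<in> U" using U(2) by blast
  have mem: "Lower P {u} \<in> ?F" using u by blast
  obtain M where M: "M \<in> ?F"
    and min: "\<And>V. (V, M) \<in> {(V, W). fin_gen_lower_set P V \<and> fin_gen_lower_set P W \<and> V \<subset> W} \<Longrightarrow> V \<notin> ?F"
    by (rule wfE_min[OF wf_fin_gen_lower_sets[OF P wf] mem]) (rule that)
  from M obtain Y where Y: "finite Y" "Y \<noteq> {}" "Y \<subseteq> U" "M = Lower P Y" by blast
  \<comment> \<open>Otherwise adding \<open>v\<close> to \<open>Y\<close> would give a strictly
    smaller member of \<open>?F\<close>, against the minimality of \<open>M\<close>.\<close>
  have "M \<subseteq> down P {v}" if v: "v \<in> U" for v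
  proof (rule ccontr)
    assume n: "\<not> M \<subseteq> down P {v}"
    have eq: "Lower P (insert v Y) = down P {v} \<inter> M" using Lower_insert v U(1) Y(4) by auto
    have sub: "Lower P (insert v Y) \<subset> M" unfolding eq using n by blast
    have "fin_gen_lower_set P (Lower P (insert v Y))" "fin_gen_lower_set P M"
      using Y v U(1) by (auto intro!: finite_case)
    with min sub have "Lower P (insert v Y) \<notin> ?F" by blast
    then show False using Y v by blast
  qed
  then have "M \<subseteq> Lower P U" using Y by (auto simp: Lower_def down_def)
  moreover have "Lower P U \<subseteq> M" using Y by (auto simp: Lower_def)
  ultimately have "Lower P U = M" by blast
  then show ?thesis using Y U(1) finite_case by auto
qed

text \<open>A bound \<open>u\<close> of the elements treated so far avoids \<open>w\<close>;
  applying \<open>sep\<close> to the next element and \<open>u\<close> gives the bound for the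
  larger set.\<close>

lemma exists_bound_avoiding:
  assumes P: "partial_order P"
    and sep: "\<And>w x y. w \<in> carrier P \<Longrightarrow> x \<in> carrier P \<Longrightarrow> y \<in> carrier P \<Longrightarrow>
      \<not> w \<sqsubseteq>\<^bsub>P\<^esub> x \<Longrightarrow> \<not> w \<sqsubseteq>\<^bsub>P\<^esub> y \<Longrightarrow> \<exists>u\<in>carrier P. x \<sqsubseteq>\<^bsub>P\<^esub> u \<and> y \<sqsubseteq>\<^bsub>P\<^esub> u \<and> \<not> w \<sqsubseteq>\<^bsub>P\<^esub> u"
    and "finite X" "X \<noteq> {}" "X \<subseteq> carrier P" "w \<in> carrier P" "\<forall>x\<in>X. \<not> w \<sqsubseteq>\<^bsub>P\<^esub> x"
  shows "\<exists>u\<in>Upper P X. \<not> w \<sqsubseteq>\<^bsub>P\<^esub> u"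
  using assms(3-7)
proof (induction X rule: finite_ne_induct)
  case (singleton x)
  interpret partial_order P by fact
  show ?case using singleton by (auto simp: Upper_def)
next
  case (insert x X)
  interpret partial_order P by fact
  obtain u where u: "u \<in> Upper P X" "\<not> w \<sqsubseteq>\<^bsub>P\<^esub> u" using insert by auto
  then obtain v where v: "v \<in> carrier P" "x \<sqsubseteq>\<^bsub>P\<^esub> v" "u \<sqsubseteq>\<^bsub>P\<^esub> v" "\<not> w \<sqsubseteq>\<^bsub>P\<^esub> v"
    using sep[of w x u] insert.prems by (auto simp: Upper_def)
  then have "v \<in> Upper P (insert x X)"
    using u by (auto simp: Upper_def intro: le_trans)
  with v show ?case by blast
qed

text \<open>An element below none of the generators is excluded from the closure by an upper bound
  of the generators that avoids it. The assumption that \<open>W\<close> is nonempty gives at least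
  one generator to start from.\<close>

lemma fin_gen_closed:
  assumes P: "partial_order P"
    and sep: "\<And>w x y. w \<in> carrier P \<Longrightarrow> x \<in> carrier P \<Longrightarrow> y \<in> carrier P \<Longrightarrow>
      \<not> w \<sqsubseteq>\<^bsub>P\<^esub> x \<Longrightarrow> \<not> w \<sqsubseteq>\<^bsub>P\<^esub> y \<Longrightarrow> \<exists>u\<in>carrier P. x \<sqsubseteq>\<^bsub>P\<^esub> u \<and> y \<sqsubseteq>\<^bsub>P\<^esub> u \<and> \<not> w \<sqsubseteq>\<^bsub>P\<^esub> u"
    and W: "fin_gen_lower_set P W" "W \<noteq> {}"
  shows "closed_lower_set P W"
proof -
  interpret partial_order P by fact
  obtain X where X: "X \<subseteq> carrier P" "finite X" "W = down P X"
    using W by (auto simp: fin_gen_lower_set_def)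
  have "X \<noteq> {}" using X W(2) by (auto simp: down_def)
  have Wc: "W \<subseteq> carrier P" using X by (auto simp: down_def)
  have up: "Upper P X \<subseteq> Upper P W"
  proof
    fix u assume u: "u \<in> Upper P X"
    show "u \<in> Upper P W"
    proof (rule Upper_memI)
      fix y assume "y \<in> W"
      then obtain x where "x \<in> X" "y \<sqsubseteq>\<^bsub>P\<^esub> x" "y \<in> carrier P" using X by (auto simp: down_def)
      then show "y \<sqsubseteq>\<^bsub>P\<^esub> u" using u X(1) le_trans[of y x u] by (auto simp: Upper_def)
    qed (use u in \<open>auto simp: Upper_def\<close>)
  qed
  have "Lower P (Upper P W) \<subseteq> W"
  proof
    fix w assume w: "w \<in> Lower P (Upper P W)"
    then have wc: "w \<in> carrier P" and wu: "\<And>u. u \<in> Upper P X \<Longrightarrow> w \<sqsubseteq>\<^bsub>P\<^esub> u"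
      using up by (auto simp: Lower_def Upper_def)
    then have "\<exists>x\<in>X. w \<sqsubseteq>\<^bsub>P\<^esub> x"
      using exists_bound_avoiding[OF P sep X(2) \<open>X \<noteq> {}\<close> X(1) wc] by blast
    then show "w \<in> W" using X(3) wc by (auto simp: down_def)
  qed
  then show ?thesis
    using subset_Lower_Upper[OF Wc] lower_set_down[OF P X(1)] X(3)
    by (auto simp: closed_lower_set_def)
qed

text \<open>A criterion for arbitrary orders with least element \<open>b\<close>; for words,
  \<open>b\<close> is the empty word. A closed set without upper bounds is the carrier, and any
  other is the set of lower bounds of a nonempty set.\<close>

lemma closed_sets_are_wf_lattice_of_fin_genI:
  assumes P: "partial_order P" and wf: "well_founded P"
    and bot: "b \<in> carrier P" "\<And>x. x \<in> carrier P \<Longrightarrow> b \<sqsubseteq>\<^bsub>P\<^esub> x"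
    and ideals: "\<And>x y. x \<in> carrier P \<Longrightarrow> y \<in> carrier P \<Longrightarrow> fin_gen_lower_set P (down P {x} \<inter> down P {y})"
    and sep: "\<And>w x y. w \<in> carrier P \<Longrightarrow> x \<in> carrier P \<Longrightarrow> y \<in> carrier P \<Longrightarrow>
      \<not> w \<sqsubseteq>\<^bsub>P\<^esub> x \<Longrightarrow> \<not> w \<sqsubseteq>\<^bsub>P\<^esub> y \<Longrightarrow> \<exists>u\<in>carrier P. x \<sqsubseteq>\<^bsub>P\<^esub> u \<and> y \<sqsubseteq>\<^bsub>P\<^esub> u \<and> \<not> w \<sqsubseteq>\<^bsub>P\<^esub> u"
  shows "closed_sets_are_wf_lattice_of_fin_gen P"
proof -
  have char: "closed_lower_set P W \<longleftrightarrow> W = carrier P \<or> fin_gen_lower_set P W \<and> W \<noteq> {}" for W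
  proof
    assume W: "closed_lower_set P W"
    then have eq: "W = Lower P (Upper P W)" by (simp add: closed_lower_set_def)
    show "W = carrier P \<or> fin_gen_lower_set P W \<and> W \<noteq> {}"
    proof (cases "Upper P W = {}")
      case True
      then show ?thesis using eq by simp
    next
      case False
      \<comment> \<open>The least element keeps every closed set nonempty.\<close>
      have "b \<in> Lower P (Upper P W)" using bot by (auto simp: Lower_def)
      then show ?thesis
        using fin_gen_Lower[OF P wf ideals _ False] eq by (auto simp: Upper_def)
    qed
  next
    assume "W = carrier P \<or> fin_gen_lower_set P W \<and> W \<noteq> {}"
    moreover have "closed_lower_set P (carrier P)"
      using subset_Lower_Upper[of "carrier P" P] by (auto simp: closed_lower_set_def lower_set_def)
    ultimately show "closed_lower_set P W" using fin_gen_closed[OF P sep] by blast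
  qed
  have "well_founded (closed_lower_sets P)"
    unfolding well_founded_def
  proof
    assume "\<exists>f. \<forall>n::nat. f n \<in> carrier (closed_lower_sets P) \<and> f (Suc n) \<sqsubset>\<^bsub>closed_lower_sets P\<^esub> f n"
    then obtain f :: "nat \<Rightarrow> 'a set"
      where f: "\<And>n. closed_lower_set P (f n)" and less: "\<And>n. f (Suc n) \<subset> f n"
      by (auto simp: closed_lower_sets_def lless_def)
    \<comment> \<open>Only the first member of a strictly descending chain can be the whole carrier,
      so the chain is shifted by one before the chain condition for finitely generated sets is
      applied.\<close>
    have "f (Suc n) \<noteq> carrier P" for n
      using less[of n] f[of n] by (auto simp: closed_lower_set_def lower_set_def)
    then have "fin_gen_lower_set P (f (Suc n))" for n using f char by blast
    then have "(f (Suc (Suc n)), f (Suc n)) \<in>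
        {(V, W). fin_gen_lower_set P V \<and> fin_gen_lower_set P W \<and> V \<subset> W}" for n
      using less by blast
    then show False
      using wf_fin_gen_lower_sets[OF P wf] unfolding wf_iff_no_infinite_down_chain
      by (auto dest!: spec[of _ "\<lambda>n. f (Suc n)"])
  qed
  then show ?thesis
    unfolding closed_sets_are_wf_lattice_of_fin_gen_def
    using lattice_closed_lower_sets[OF P] char by (auto simp: closed_lower_sets_def)
qed

section \<open>The order on words\<close>

lemma words_simps [simp]:
  "carrier (words \<Lambda>) = lists (carrier \<Lambda>)" "le (words \<Lambda>) = list_emb (le \<Lambda>)" "eq (words \<Lambda>) = (=)"
  by (simp_all add: words_def)

text \<open>Embeddings in both directions force equal lengths, so no letter is skipped and the words
  are compared letter by letter. Antisymmetry is asked only for letters that occur, since it is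
  known only on the carrier.\<close>

lemma list_emb_antisym:
  assumes "list_emb R xs ys" "list_emb R ys xs"
    and "\<And>x y. x \<in> set xs \<Longrightarrow> y \<in> set ys \<Longrightarrow> R x y \<Longrightarrow> R y x \<Longrightarrow> x = y"
  shows "xs = ys"
  using assms
proof induction
  case (list_emb_Cons xs ys y)
  then show ?case by (auto dest!: list_emb_length)
next
  case (list_emb_Cons2 x y xs ys)
  have len: "length xs \<le> length ys" using list_emb_Cons2.hyps(2) by (rule list_emb_length)
  \<comment> \<open>Skipping \<open>x\<close> would embed \<open>y # ys\<close> into
    \<open>xs\<close>, which is too short.\<close>
  have R: "R y x \<and> list_emb R ys xs"
    using list_emb_Cons2.prems(1)
  proof cases
    case list_emb_Cons
    then have "length (y # ys) \<le> length xs" by (auto dest: list_emb_length)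
    with len show ?thesis by simp
  qed auto
  then show ?case using list_emb_Cons2 by auto
qed (metis list_emb_Nil2)

lemma partial_order_words:
  assumes "partial_order \<Lambda>" shows "partial_order (words \<Lambda>)"
proof -
  interpret partial_order \<Lambda> by fact
  have [simp]: "x .=\<^bsub>words \<Lambda>\<^esub> y \<longleftrightarrow> x = y" for x y by simp
  show ?thesis
  proof unfold_locales
    fix x assume "x \<in> carrier (words \<Lambda>)"
    then show "x \<sqsubseteq>\<^bsub>words \<Lambda>\<^esub> x" by (auto intro!: list_emb_refl)
  next
    fix x y assume "x \<sqsubseteq>\<^bsub>words \<Lambda>\<^esub> y" "y \<sqsubseteq>\<^bsub>words \<Lambda>\<^esub> x" "x \<in> carrier (words \<Lambda>)" "y \<in> carrier (words \<Lambda>)"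
    then show "x .=\<^bsub>words \<Lambda>\<^esub> y" by (auto intro!: list_emb_antisym[of "le \<Lambda>" x y])
  next
    fix x y z assume "x \<sqsubseteq>\<^bsub>words \<Lambda>\<^esub> y" "y \<sqsubseteq>\<^bsub>words \<Lambda>\<^esub> z"
      "x \<in> carrier (words \<Lambda>)" "y \<in> carrier (words \<Lambda>)" "z \<in> carrier (words \<Lambda>)"
    then show "x \<sqsubseteq>\<^bsub>words \<Lambda>\<^esub> z"
      using list_emb_trans[of x y z "le \<Lambda>"] le_trans by (simp add: in_lists_conv_set)
  qed auto
qed

text \<open>Passing to a proper subword deletes letters or decreases them, and either change lowers
  the multiset of letters.\<close>

lemma well_founded_words:
  assumes P: "partial_order \<Lambda>" and wf: "well_founded \<Lambda>" shows "well_founded (words \<Lambda>)"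
  unfolding well_founded_iff_wf
proof (rule wf_subset)
  let ?m = "mult (strict_rel \<Lambda>)"
  show "wf (inv_image ?m mset)" using wf by (simp add: well_founded_iff_wf wf_mult)
  have tr: "trans ?m" using trans_strict_rel[OF P] by (rule trans_mult)
  have irr: "irrefl_on A (strict_rel \<Lambda>)" for A
    by (auto simp: irrefl_on_def strict_rel_def lless_iff[OF P])
  have "u = v \<or> (mset u, mset v) \<in> ?m"
    if "list_emb (le \<Lambda>) u v" "u \<in> lists (carrier \<Lambda>)" "v \<in> lists (carrier \<Lambda>)" for u v
    using that
  proof induction
    case (list_emb_Nil ys)
    then show ?case by (cases ys) (auto intro!: subset_implies_mult simp: subset_mset_def)
  next
    case (list_emb_Cons xs ys y)
    have "(mset ys, mset (y # ys)) \<in> ?m" by (rule subset_implies_mult) simp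
    then show ?case using list_emb_Cons tr by (auto dest: transD)
  next
    case (list_emb_Cons2 x y xs ys)
    have xy: "x = y \<or> (x, y) \<in> strict_rel \<Lambda>"
      using list_emb_Cons2 by (auto simp: strict_rel_def lless_iff[OF P])
    \<comment> \<open>The change from \<open>x # xs\<close> to \<open>y # ys\<close> is split in
      two: first the head, then the tail.\<close>
    have 1: "x = y \<or> (mset (x # xs), mset (y # xs)) \<in> ?m"
      using xy one_step_implies_mult[of "{#y#}" "{#x#}" "strict_rel \<Lambda>" "mset xs"] by auto
    have 2: "xs = ys \<or> (mset (y # xs), mset (y # ys)) \<in> ?m"
      using list_emb_Cons2 mult_cancel_add_mset[OF trans_strict_rel[OF P] irr] by auto
    show ?case using 1 2 tr by (auto dest: transD)
  qed
  then show "strict_rel (words \<Lambda>) \<subseteq> inv_image ?m mset"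
    unfolding strict_rel_def[of "words \<Lambda>"] lless_def by fastforce
qed

section \<open>Common upper bounds of two words and intersections of their ideals\<close>

text \<open>Correctness of the greedy merge. The induction is on the total length of all three
  words, because a step shortens either one of \<open>x\<close> and \<open>y\<close> or all three
  words. When one of \<open>x\<close> and \<open>y\<close> is empty, the other is the bound.\<close>

lemma words_bound_avoiding:
  assumes P: "partial_order \<Lambda>"
    and ub: "\<And>a b c. a \<in> carrier \<Lambda> \<Longrightarrow> b \<in> carrier \<Lambda> \<Longrightarrow> c \<in> carrier \<Lambda> \<Longrightarrow> c \<sqsubseteq>\<^bsub>\<Lambda>\<^esub> a \<Longrightarrow> c \<sqsubseteq>\<^bsub>\<Lambda>\<^esub> b \<Longrightarrow>
      \<exists>d\<in>carrier \<Lambda>. a \<sqsubseteq>\<^bsub>\<Lambda>\<^esub> d \<and> b \<sqsubseteq>\<^bsub>\<Lambda>\<^esub> d"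
    and "w \<in> lists (carrier \<Lambda>)" "x \<in> lists (carrier \<Lambda>)" "y \<in> lists (carrier \<Lambda>)"
    and "\<not> list_emb (le \<Lambda>) w x" "\<not> list_emb (le \<Lambda>) w y"
  shows "\<exists>u\<in>lists (carrier \<Lambda>). list_emb (le \<Lambda>) x u \<and> list_emb (le \<Lambda>) y u \<and> \<not> list_emb (le \<Lambda>) w u"
  using assms(3-7)
proof (induction "length w + length x + length y" arbitrary: w x y rule: less_induct)
  case less
  interpret partial_order \<Lambda> by fact
  have refl: "v \<in> lists (carrier \<Lambda>) \<Longrightarrow> list_emb (le \<Lambda>) v v" for v
    by (rule list_emb_refl) auto
  obtain c w' where w: "w = c # w'" using less.prems by (cases w) auto
  show ?case
  proof (cases "x = [] \<or> y = []")
    case True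
    then show ?thesis using less.prems refl by (metis list_emb_Nil)
  next
    case False
    then obtain a x' b y' where xy: "x = a # x'" "y = b # y'" by (auto simp: neq_Nil_conv)
    consider "\<not> c \<sqsubseteq>\<^bsub>\<Lambda>\<^esub> a" | "\<not> c \<sqsubseteq>\<^bsub>\<Lambda>\<^esub> b" | "c \<sqsubseteq>\<^bsub>\<Lambda>\<^esub> a" "c \<sqsubseteq>\<^bsub>\<Lambda>\<^esub> b" by blast
    then show ?thesis
    proof cases
      \<comment> \<open>The letter \<open>a\<close> cannot host the first letter of
        \<open>w\<close>, so putting it in front of \<open>u\<close> creates no embedding of
        \<open>w\<close>.\<close>
      case 1
      then obtain u where "u \<in> lists (carrier \<Lambda>)" "list_emb (le \<Lambda>) x' u" "list_emb (le \<Lambda>) y u"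
        "\<not> list_emb (le \<Lambda>) w u"
        using less.hyps[of w x' y] less.prems w xy by auto
      with 1 show ?thesis
        using less.prems w xy by (intro bexI[of _ "a # u"]) auto
    next
      case 2
      then obtain u where "u \<in> lists (carrier \<Lambda>)" "list_emb (le \<Lambda>) x u" "list_emb (le \<Lambda>) y' u"
        "\<not> list_emb (le \<Lambda>) w u"
        using less.hyps[of w x y'] less.prems w xy by auto
      with 2 show ?thesis
        using less.prems w xy by (intro bexI[of _ "b # u"]) auto
    next
      \<comment> \<open>Since \<open>c\<close> is below \<open>a\<close> and \<open>b\<close>, the
        tail \<open>w'\<close> is below neither tail. With \<open>c\<close> below \<open>d\<close>
        as well, \<open>w\<close> embeds in \<open>d # u\<close> only if \<open>w'\<close> embeds in
        \<open>u\<close>.\<close>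
      case 3
      then obtain u where u: "u \<in> lists (carrier \<Lambda>)" "list_emb (le \<Lambda>) x' u" "list_emb (le \<Lambda>) y' u"
        "\<not> list_emb (le \<Lambda>) w' u"
        using less.hyps[of w' x' y'] less.prems w xy by auto
      obtain d where d: "d \<in> carrier \<Lambda>" "a \<sqsubseteq>\<^bsub>\<Lambda>\<^esub> d" "b \<sqsubseteq>\<^bsub>\<Lambda>\<^esub> d"
        using ub[of a b c] 3 less.prems w xy by auto
      then have "c \<sqsubseteq>\<^bsub>\<Lambda>\<^esub> d" using 3 less.prems w xy le_trans[of c a d] by auto
      with u d show ?thesis
        using less.prems w xy by (intro bexI[of _ "d # u"]) auto
    qed
  qed
qed

text \<open>A word below both \<open>a # x'\<close> and \<open>b # y'\<close> either embeds without
  using \<open>a\<close>, or without using \<open>b\<close>, or its first letter is a common lower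
  bound of \<open>a\<close> and \<open>b\<close>. The three cases give a recursive description of
  the intersection.\<close>

lemma words_ideals_Int_fin_gen:
  assumes P: "partial_order \<Lambda>"
    and lb: "\<And>a b. a \<in> carrier \<Lambda> \<Longrightarrow> b \<in> carrier \<Lambda> \<Longrightarrow>
      fin_gen_lower_set \<Lambda> {c\<in>carrier \<Lambda>. c \<sqsubseteq>\<^bsub>\<Lambda>\<^esub> a \<and> c \<sqsubseteq>\<^bsub>\<Lambda>\<^esub> b}"
    and "x \<in> lists (carrier \<Lambda>)" "y \<in> lists (carrier \<Lambda>)"
  shows "fin_gen_lower_set (words \<Lambda>) (down (words \<Lambda>) {x} \<inter> down (words \<Lambda>) {y})"
  using assms(3-4)
proof (induction "length x + length y" arbitrary: x y rule: less_induct)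
  case less
  interpret partial_order \<Lambda> by fact
  interpret W: partial_order "words \<Lambda>" using P by (rule partial_order_words)
  let ?D = "\<lambda>x y. down (words \<Lambda>) {x} \<inter> down (words \<Lambda>) {y}"
  show ?case
  proof (cases "x = [] \<or> y = []")
    case True
    then have "?D x y = down (words \<Lambda>) {[]}" by (auto simp: down_def dest: list_emb_Nil2)
    then show ?thesis by (intro fin_gen_lower_setI[of "{[]}"]) auto
  next
    case False
    then obtain a x' b y' where xy: "x = a # x'" "y = b # y'" by (auto simp: neq_Nil_conv)
    have car: "a \<in> carrier \<Lambda>" "b \<in> carrier \<Lambda>" "x' \<in> lists (carrier \<Lambda>)" "y' \<in> lists (carrier \<Lambda>)"
      using less.prems xy by auto
    obtain G where G: "G \<subseteq> carrier \<Lambda>" "finite G"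
      "{c\<in>carrier \<Lambda>. c \<sqsubseteq>\<^bsub>\<Lambda>\<^esub> a \<and> c \<sqsubseteq>\<^bsub>\<Lambda>\<^esub> b} = down \<Lambda> G"
      using lb[OF car(1,2)] by (auto simp: fin_gen_lower_set_def)
    have "fin_gen_lower_set (words \<Lambda>) (?D x' y')"
      using less.hyps[of x' y'] car xy by simp
    then obtain H where H: "H \<subseteq> lists (carrier \<Lambda>)" "finite H" "?D x' y' = down (words \<Lambda>) H"
      by (auto simp: fin_gen_lower_set_def)
    \<comment> \<open>Generators for the third case: a generator of the common lower bounds of
      \<open>a\<close> and \<open>b\<close>, followed by a generator of the intersection for the
      tails.\<close>
    let ?C = "(\<lambda>(c, v). c # v) ` (G \<times> H)"
    have C: "?C \<subseteq> lists (carrier \<Lambda>)" using G(1) H(1) by (fastforce simp del: in_lists_conv_set)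
    have Gab: "c \<sqsubseteq>\<^bsub>\<Lambda>\<^esub> a" "c \<sqsubseteq>\<^bsub>\<Lambda>\<^esub> b" if "c \<in> G" for c
    proof -
      have "c \<in> down \<Lambda> G" using that G(1) by (force simp: down_def)
      then show "c \<sqsubseteq>\<^bsub>\<Lambda>\<^esub> a" "c \<sqsubseteq>\<^bsub>\<Lambda>\<^esub> b" unfolding G(3)[symmetric] by auto
    qed
    have Hxy: "list_emb (le \<Lambda>) v x'" "list_emb (le \<Lambda>) v y'" if "v \<in> H" for v
    proof -
      have "v \<in> down (words \<Lambda>) H" using that H(1) W.le_refl[of v] by (auto simp: down_def)
      then show "list_emb (le \<Lambda>) v x'" "list_emb (le \<Lambda>) v y'"
        unfolding H(3)[symmetric] by (auto simp: down_def)
    qed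
    have "?D x y = ?D x' y \<union> ?D x y' \<union> down (words \<Lambda>) ?C"
    proof
      show "?D x y \<subseteq> ?D x' y \<union> ?D x y' \<union> down (words \<Lambda>) ?C"
      proof
        fix w assume w: "w \<in> ?D x y"
        then have wc: "w \<in> lists (carrier \<Lambda>)" and wx: "list_emb (le \<Lambda>) w (a # x')"
          and wy: "list_emb (le \<Lambda>) w (b # y')" using xy by (auto simp: down_def)
        show "w \<in> ?D x' y \<union> ?D x y' \<union> down (words \<Lambda>) ?C"
        proof (cases "list_emb (le \<Lambda>) w x' \<or> list_emb (le \<Lambda>) w y'")
          case True
          then show ?thesis using w wc by (auto simp: down_def)
        next
          case False
          then obtain c v where cv: "w = c # v" by (cases w) auto
          \<comment> \<open>As \<open>w\<close> embeds in neither tail, its first letter must be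
            matched with \<open>a\<close> and with \<open>b\<close>.\<close>
          have ca: "c \<sqsubseteq>\<^bsub>\<Lambda>\<^esub> a" "c \<sqsubseteq>\<^bsub>\<Lambda>\<^esub> b"
            using False wx wy cv list_emb_Cons_iff2 by metis+
          then have vx: "list_emb (le \<Lambda>) v x'" "list_emb (le \<Lambda>) v y'"
            using wx wy cv by auto
          have "c \<in> down \<Lambda> G" using ca wc cv G(3) by auto
          then obtain g where g: "g \<in> G" "c \<sqsubseteq>\<^bsub>\<Lambda>\<^esub> g" by (auto simp: down_def)
          have "v \<in> ?D x' y'" using vx wc cv by (auto simp: down_def)
          then obtain h where h: "h \<in> H" "list_emb (le \<Lambda>) v h"
            unfolding H(3) by (auto simp: down_def)
          have "list_emb (le \<Lambda>) w (g # h)" using g h cv by auto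
          then show ?thesis using g h wc by (auto simp: down_def)
        qed
      qed
      have "?D x' y \<union> ?D x y' \<subseteq> ?D x y" using xy by (auto simp: down_def)
      moreover have "down (words \<Lambda>) ?C \<subseteq> ?D x y"
      proof
        fix w assume "w \<in> down (words \<Lambda>) ?C"
        then obtain c v where cv: "c \<in> G" "v \<in> H" "list_emb (le \<Lambda>) w (c # v)"
          and w: "w \<in> lists (carrier \<Lambda>)" by (auto simp: down_def)
        have "list_emb (le \<Lambda>) (c # v) x" "list_emb (le \<Lambda>) (c # v) y"
          using Gab[OF cv(1)] Hxy[OF cv(2)] xy by auto
        moreover have "c # v \<in> lists (carrier \<Lambda>)" using cv C by auto
        ultimately have "list_emb (le \<Lambda>) w x" "list_emb (le \<Lambda>) w y"
          using W.le_trans[of w "c # v"] cv w less.prems by auto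
        then show "w \<in> ?D x y" using w by (auto simp: down_def)
      qed
      ultimately show "?D x' y \<union> ?D x y' \<union> down (words \<Lambda>) ?C \<subseteq> ?D x y" by blast
    qed
    moreover have "fin_gen_lower_set (words \<Lambda>) (?D x' y)" "fin_gen_lower_set (words \<Lambda>) (?D x y')"
      using less.hyps[of x' y] less.hyps[of x y'] less.prems car xy by simp_all
    moreover have "fin_gen_lower_set (words \<Lambda>) (down (words \<Lambda>) ?C)"
      using C G(2) H(2) by (intro fin_gen_lower_setI[of ?C]) auto
    ultimately show ?thesis by (simp add: fin_gen_lower_set_Un)
  qed
qed

section \<open>The characterisation\<close>

lemma closed_sets_words_sufficient:
  assumes P: "partial_order \<Lambda>" and wf: "well_founded \<Lambda>"
    and ub: "\<And>a b. a \<in> carrier \<Lambda> \<Longrightarrow> b \<in> carrier \<Lambda> \<Longrightarrow> compatible \<Lambda> a b \<Longrightarrow> incomparable \<Lambda> a b \<Longrightarrow>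
      \<exists>d\<in>carrier \<Lambda>. a \<sqsubseteq>\<^bsub>\<Lambda>\<^esub> d \<and> b \<sqsubseteq>\<^bsub>\<Lambda>\<^esub> d"
    and lb: "\<And>a b. a \<in> carrier \<Lambda> \<Longrightarrow> b \<in> carrier \<Lambda> \<Longrightarrow> compatible \<Lambda> a b \<Longrightarrow> incomparable \<Lambda> a b \<Longrightarrow>
      fin_gen_lower_set \<Lambda> {c\<in>carrier \<Lambda>. c \<sqsubseteq>\<^bsub>\<Lambda>\<^esub> a \<and> c \<sqsubseteq>\<^bsub>\<Lambda>\<^esub> b}"
  shows "closed_sets_are_wf_lattice_of_fin_gen (words \<Lambda>)"
proof -
  interpret partial_order \<Lambda> by fact
  \<comment> \<open>For comparable letters the larger one is an upper bound.\<close>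
  have ub': "\<exists>d\<in>carrier \<Lambda>. a \<sqsubseteq>\<^bsub>\<Lambda>\<^esub> d \<and> b \<sqsubseteq>\<^bsub>\<Lambda>\<^esub> d"
    if "a \<in> carrier \<Lambda>" "b \<in> carrier \<Lambda>" "c \<in> carrier \<Lambda>" "c \<sqsubseteq>\<^bsub>\<Lambda>\<^esub> a" "c \<sqsubseteq>\<^bsub>\<Lambda>\<^esub> b" for a b c
    using that ub[of a b] by (auto simp: compatible_def incomparable_def)
  \<comment> \<open>For comparable letters the smaller one generates the common lower bounds; for
    incompatible ones the empty set does.\<close>
  have lb': "fin_gen_lower_set \<Lambda> {c\<in>carrier \<Lambda>. c \<sqsubseteq>\<^bsub>\<Lambda>\<^esub> a \<and> c \<sqsubseteq>\<^bsub>\<Lambda>\<^esub> b}"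
    if ab: "a \<in> carrier \<Lambda>" "b \<in> carrier \<Lambda>" for a b
  proof -
    consider "a \<sqsubseteq>\<^bsub>\<Lambda>\<^esub> b" | "b \<sqsubseteq>\<^bsub>\<Lambda>\<^esub> a" | "\<not> compatible \<Lambda> a b" | "compatible \<Lambda> a b" "incomparable \<Lambda> a b"
      by (auto simp: incomparable_def)
    then show ?thesis
    proof cases
      case 1
      then show ?thesis using ab
        by (intro fin_gen_lower_setI[of "{a}"]) (auto simp: down_def intro: le_trans)
    next
      case 2
      then show ?thesis using ab
        by (intro fin_gen_lower_setI[of "{b}"]) (auto simp: down_def intro: le_trans)
    next
      case 3
      then show ?thesis
        by (intro fin_gen_lower_setI[of "{}"]) (auto simp: down_def compatible_def)
    qed (use lb ab in blast)
  qed
  show ?thesis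
  proof (rule closed_sets_are_wf_lattice_of_fin_genI)
    show "partial_order (words \<Lambda>)" "well_founded (words \<Lambda>)"
      using partial_order_words well_founded_words P wf by auto
    show "[] \<in> carrier (words \<Lambda>)" by simp
    show "[] \<sqsubseteq>\<^bsub>words \<Lambda>\<^esub> x" for x by simp
    show "fin_gen_lower_set (words \<Lambda>) (down (words \<Lambda>) {x} \<inter> down (words \<Lambda>) {y})"
      if "x \<in> carrier (words \<Lambda>)" "y \<in> carrier (words \<Lambda>)" for x y
      using words_ideals_Int_fin_gen[OF P lb'] that by simp
    show "\<exists>u\<in>carrier (words \<Lambda>). x \<sqsubseteq>\<^bsub>words \<Lambda>\<^esub> u \<and> y \<sqsubseteq>\<^bsub>words \<Lambda>\<^esub> u \<and> \<not> w \<sqsubseteq>\<^bsub>words \<Lambda>\<^esub> u"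
      if "w \<in> carrier (words \<Lambda>)" "x \<in> carrier (words \<Lambda>)" "y \<in> carrier (words \<Lambda>)"
        "\<not> w \<sqsubseteq>\<^bsub>words \<Lambda>\<^esub> x" "\<not> w \<sqsubseteq>\<^bsub>words \<Lambda>\<^esub> y" for w x y
      using words_bound_avoiding[OF P ub'] that by simp
  qed
qed

section \<open>Necessity, by means of one-letter words\<close>

lemma list_emb_singleton_right: "list_emb R w [a] \<longleftrightarrow> w = [] \<or> (\<exists>c. w = [c] \<and> R c a)"
  by (subst list_emb.simps) (auto dest: list_emb_Nil2)

lemma list_emb_singleton_left: "list_emb R [a] w \<longleftrightarrow> (\<exists>c\<in>set w. R a c)"
proof
  assume "list_emb R [a] w"
  then show "\<exists>c\<in>set w. R a c" by (rule list_emb_set[of R "[a]" w a]) auto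
next
  assume "\<exists>c\<in>set w. R a c"
  then show "list_emb R [a] w" by (induction w) auto
qed

text \<open>Distinct letters occupy distinct positions of \<open>w\<close>. Their order is
  irrelevant, as both are above the same letter \<open>c\<close>.\<close>

lemma list_emb_two_letters:
  assumes "p \<in> set w" "q \<in> set w" "p \<noteq> q" "R c p" "R c q"
  shows "list_emb R [c, c] w"
  using assms
proof (induction w)
  case (Cons d w)
  then show ?case
  proof (cases "d = p \<or> d = q")
    case True
    then have "R c d" "list_emb R [c] w"
      using Cons.prems unfolding list_emb_singleton_left by auto
    then show ?thesis by simp
  qed auto
qed simp

lemma closed_sets_words_necessary:
  assumes P: "partial_order \<Lambda>" and C: "closed_sets_are_wf_lattice_of_fin_gen (words \<Lambda>)"
  shows "well_founded \<Lambda>"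
    and "a \<in> carrier \<Lambda> \<Longrightarrow> b \<in> carrier \<Lambda> \<Longrightarrow> compatible \<Lambda> a b \<Longrightarrow>
      \<exists>d\<in>carrier \<Lambda>. a \<sqsubseteq>\<^bsub>\<Lambda>\<^esub> d \<and> b \<sqsubseteq>\<^bsub>\<Lambda>\<^esub> d"
    and "a \<in> carrier \<Lambda> \<Longrightarrow> b \<in> carrier \<Lambda> \<Longrightarrow> incomparable \<Lambda> a b \<Longrightarrow>
      fin_gen_lower_set \<Lambda> {c\<in>carrier \<Lambda>. c \<sqsubseteq>\<^bsub>\<Lambda>\<^esub> a \<and> c \<sqsubseteq>\<^bsub>\<Lambda>\<^esub> b}"
proof -
  interpret partial_order \<Lambda> by fact
  interpret W: partial_order "words \<Lambda>" using P by (rule partial_order_words)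
  have closed_iff: "closed_lower_set (words \<Lambda>) W \<longleftrightarrow>
      W = lists (carrier \<Lambda>) \<or> fin_gen_lower_set (words \<Lambda>) W \<and> W \<noteq> {}" for W
  proof -
    have "{W. closed_lower_set (words \<Lambda>) W} =
        {lists (carrier \<Lambda>)} \<union> {W. fin_gen_lower_set (words \<Lambda>) W \<and> W \<noteq> {}}"
      using C by (simp add: closed_sets_are_wf_lattice_of_fin_gen_def closed_lower_sets_def)
    then have "W \<in> {W. closed_lower_set (words \<Lambda>) W} \<longleftrightarrow>
        W \<in> {lists (carrier \<Lambda>)} \<union> {W. fin_gen_lower_set (words \<Lambda>) W \<and> W \<noteq> {}}"
      by (rule arg_cong)
    then show ?thesis by simp
  qed
  have Nil_down: "X \<noteq> {} \<Longrightarrow> [] \<in> down (words \<Lambda>) X" for X by (auto simp: down_def)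
  have closed_down: "closed_lower_set (words \<Lambda>) (down (words \<Lambda>) X)"
    if "finite X" "X \<noteq> {}" "X \<subseteq> lists (carrier \<Lambda>)" for X
  proof -
    have "fin_gen_lower_set (words \<Lambda>) (down (words \<Lambda>) X)"
      using that by (intro fin_gen_lower_setI[of X]) auto
    then show ?thesis unfolding closed_iff using Nil_down[OF that(2)] by blast
  qed
  show "well_founded \<Lambda>" unfolding well_founded_def
  proof
    assume "\<exists>f. \<forall>n::nat. f n \<in> carrier \<Lambda> \<and> f (Suc n) \<sqsubset>\<^bsub>\<Lambda>\<^esub> f n"
    then obtain f :: "nat \<Rightarrow> 'a" where f: "\<And>n. f n \<in> carrier \<Lambda>"
      and less: "\<And>n. f (Suc n) \<sqsubseteq>\<^bsub>\<Lambda>\<^esub> f n" "\<And>n. f (Suc n) \<noteq> f n"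
      by (auto simp: lless_iff[OF P])
    \<comment> \<open>Principal ideals of one-letter words turn a descending chain of letters into a
      descending chain of closed sets.\<close>
    define g where "g n = down (words \<Lambda>) {[f n]}" for n
    have "g (Suc n) \<subseteq> g n" for n
      using f le_trans[OF _ less(1)[of n]] by (auto simp: g_def down_def list_emb_singleton_right)
    moreover have "g (Suc n) \<noteq> g n" for n
    proof
      assume "g (Suc n) = g n"
      moreover have "[f n] \<in> g n" using f by (auto simp: g_def down_def)
      ultimately have "[f n] \<in> g (Suc n)" by simp
      then have "f n \<sqsubseteq>\<^bsub>\<Lambda>\<^esub> f (Suc n)" by (auto simp: g_def down_def list_emb_singleton_right)
      then show False using less f le_antisym by blast
    qed
    moreover have "closed_lower_set (words \<Lambda>) (g n)" for n
      unfolding g_def using f by (intro closed_down) auto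
    ultimately have "\<forall>n. g n \<in> carrier (closed_lower_sets (words \<Lambda>)) \<and>
        g (Suc n) \<sqsubset>\<^bsub>closed_lower_sets (words \<Lambda>)\<^esub> g n"
      by (auto simp: closed_lower_sets_def lless_def)
    then show False
      using C unfolding closed_sets_are_wf_lattice_of_fin_gen_def well_founded_def by blast
  qed
  assume ab: "a \<in> carrier \<Lambda>" "b \<in> carrier \<Lambda>"
  show "\<exists>d\<in>carrier \<Lambda>. a \<sqsubseteq>\<^bsub>\<Lambda>\<^esub> d \<and> b \<sqsubseteq>\<^bsub>\<Lambda>\<^esub> d" if comp: "compatible \<Lambda> a b"
  proof (rule ccontr)
    assume none: "\<not> (\<exists>d\<in>carrier \<Lambda>. a \<sqsubseteq>\<^bsub>\<Lambda>\<^esub> d \<and> b \<sqsubseteq>\<^bsub>\<Lambda>\<^esub> d)"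
    obtain c where c: "c \<in> carrier \<Lambda>" "c \<sqsubseteq>\<^bsub>\<Lambda>\<^esub> a" "c \<sqsubseteq>\<^bsub>\<Lambda>\<^esub> b" using comp by (auto simp: compatible_def)
    let ?D = "down (words \<Lambda>) {[a], [b]}"
    have D: "Lower (words \<Lambda>) (Upper (words \<Lambda>) ?D) = ?D"
      using closed_down[of "{[a], [b]}"] ab by (simp add: closed_lower_set_def)
    have ab_D: "[a] \<in> ?D" "[b] \<in> ?D" using ab by (auto simp: down_def)
    have "list_emb (le \<Lambda>) [c, c] u" if u: "u \<in> Upper (words \<Lambda>) ?D" for u
    proof -
      have uc: "u \<in> lists (carrier \<Lambda>)" and "list_emb (le \<Lambda>) [a] u" "list_emb (le \<Lambda>) [b] u"
        using u ab_D ab by (auto simp: Upper_def)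
      then obtain p q where pq: "p \<in> set u" "q \<in> set u" "a \<sqsubseteq>\<^bsub>\<Lambda>\<^esub> p" "b \<sqsubseteq>\<^bsub>\<Lambda>\<^esub> q"
        by (auto simp: list_emb_singleton_left)
      then have car: "p \<in> carrier \<Lambda>" "q \<in> carrier \<Lambda>" using uc by auto
      \<comment> \<open>A single letter above both \<open>a\<close> and \<open>b\<close> would be
        the excluded common upper bound.\<close>
      have "p \<noteq> q" using pq car none by blast
      moreover have "c \<sqsubseteq>\<^bsub>\<Lambda>\<^esub> p" "c \<sqsubseteq>\<^bsub>\<Lambda>\<^esub> q" using pq car ab c le_trans by blast+
      ultimately show ?thesis using pq by (intro list_emb_two_letters[of p u q]) auto
    qed
    then have "[c, c] \<in> Lower (words \<Lambda>) (Upper (words \<Lambda>) ?D)"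
      using c by (auto simp: Lower_def)
    \<comment> \<open>The word \<open>[c, c]\<close> is too long to lie below \<open>[a]\<close> or
      \<open>[b]\<close>.\<close>
    then show False unfolding D by (auto simp: down_def dest: list_emb_length)
  qed
  show "fin_gen_lower_set \<Lambda> {c\<in>carrier \<Lambda>. c \<sqsubseteq>\<^bsub>\<Lambda>\<^esub> a \<and> c \<sqsubseteq>\<^bsub>\<Lambda>\<^esub> b}" if inc: "incomparable \<Lambda> a b"
  proof -
    let ?L = "Lower (words \<Lambda>) {[a], [b]}"
    have L_iff: "w \<in> ?L \<longleftrightarrow> w = [] \<or> (\<exists>c\<in>carrier \<Lambda>. w = [c] \<and> c \<sqsubseteq>\<^bsub>\<Lambda>\<^esub> a \<and> c \<sqsubseteq>\<^bsub>\<Lambda>\<^esub> b)" for w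
    proof -
      have "w \<in> ?L \<longleftrightarrow> w \<in> lists (carrier \<Lambda>) \<and> list_emb (le \<Lambda>) w [a] \<and> list_emb (le \<Lambda>) w [b]"
        using ab by (auto simp: Lower_def)
      then show ?thesis by (auto simp: list_emb_singleton_right)
    qed
    have "closed_lower_set (words \<Lambda>) ?L"
      using closed_lower_set_Lower[OF W.partial_order_axioms, of "{[a], [b]}"] ab by simp
    \<comment> \<open>This rules out that \<open>?L\<close> is the set of all words, so
      \<open>?L\<close> is finitely generated.\<close>
    moreover have "[a] \<notin> ?L" using inc by (auto simp: L_iff incomparable_def)
    moreover have "[a] \<in> lists (carrier \<Lambda>)" using ab by simp
    ultimately have "fin_gen_lower_set (words \<Lambda>) ?L" unfolding closed_iff by metis
    then obtain X where X: "X \<subseteq> lists (carrier \<Lambda>)" "finite X" "?L = down (words \<Lambda>) X"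
      by (auto simp: fin_gen_lower_set_def)
    \<comment> \<open>The generators in \<open>X\<close> have at most one letter. The empty word may
      be among them but is above no \<open>[c]\<close>, so only the one-letter words are
      kept.\<close>
    let ?G = "{c. [c] \<in> X}"
    have XL: "X \<subseteq> ?L" unfolding X(3) using X(1) W.le_refl by (force simp: down_def)
    show ?thesis
    proof (rule fin_gen_lower_setI[of ?G])
      have "(\<lambda>c. [c]) ` ?G \<subseteq> X" by auto
      then show "finite ?G" using X(2) by (meson finite_imageD finite_subset injI inj_on_subset list.inject subset_UNIV)
      show "?G \<subseteq> carrier \<Lambda>" using X(1) by auto
      show "{c\<in>carrier \<Lambda>. c \<sqsubseteq>\<^bsub>\<Lambda>\<^esub> a \<and> c \<sqsubseteq>\<^bsub>\<Lambda>\<^esub> b} = down \<Lambda> ?G"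
      proof (intro equalityI subsetI)
        fix c assume c: "c \<in> {c\<in>carrier \<Lambda>. c \<sqsubseteq>\<^bsub>\<Lambda>\<^esub> a \<and> c \<sqsubseteq>\<^bsub>\<Lambda>\<^esub> b}"
        then have "[c] \<in> ?L" by (auto simp: L_iff)
        then obtain x where x: "x \<in> X" "list_emb (le \<Lambda>) [c] x" unfolding X(3) by (auto simp: down_def)
        moreover obtain d where "x = [d]" using x XL L_iff[of x] by auto
        ultimately show "c \<in> down \<Lambda> ?G" using c by (auto simp: down_def list_emb_singleton_left)
      next
        fix c assume "c \<in> down \<Lambda> ?G"
        then obtain d where d: "c \<in> carrier \<Lambda>" "[d] \<in> X" "c \<sqsubseteq>\<^bsub>\<Lambda>\<^esub> d" by (auto simp: down_def)
        then have "d \<in> carrier \<Lambda>" "d \<sqsubseteq>\<^bsub>\<Lambda>\<^esub> a" "d \<sqsubseteq>\<^bsub>\<Lambda>\<^esub> b" using XL L_iff[of "[d]"] by auto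
        then show "c \<in> {c\<in>carrier \<Lambda>. c \<sqsubseteq>\<^bsub>\<Lambda>\<^esub> a \<and> c \<sqsubseteq>\<^bsub>\<Lambda>\<^esub> b}"
          using d ab le_trans by blast
      qed
    qed
  qed
qed

section \<open>Disjoint unions of lattices without their least elements\<close>

lemma disjoint_union_simps [simp]:
  "carrier (disjoint_union I L) = (SIGMA i:I. carrier (L i))"
  "eq (disjoint_union I L) = (=)"
  "(i, x) \<sqsubseteq>\<^bsub>disjoint_union I L\<^esub> (j, y) \<longleftrightarrow> i = j \<and> x \<sqsubseteq>\<^bsub>L i\<^esub> y"
  by (simp_all add: disjoint_union_def)

lemma remove_minimal_simps [simp]:
  "carrier (remove_minimal P) = carrier P - minimal_elements P"
  "le (remove_minimal P) = le P" "eq (remove_minimal P) = eq P"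
  by (simp_all add: remove_minimal_def)

lemma partial_order_disjoint_union:
  assumes "\<And>i. i \<in> I \<Longrightarrow> partial_order (L i)"
  shows "partial_order (disjoint_union I L)"
proof -
  have [simp]: "p .=\<^bsub>disjoint_union I L\<^esub> q \<longleftrightarrow> p = q" for p q by simp
  show ?thesis
  proof unfold_locales
    fix p assume "p \<in> carrier (disjoint_union I L)"
    then show "p \<sqsubseteq>\<^bsub>disjoint_union I L\<^esub> p"
      using weak_partial_order.le_refl[OF partial_order.axioms(1)[OF assms]] by auto
  next
    fix p q assume "p \<sqsubseteq>\<^bsub>disjoint_union I L\<^esub> q" "q \<sqsubseteq>\<^bsub>disjoint_union I L\<^esub> p"
      "p \<in> carrier (disjoint_union I L)" "q \<in> carrier (disjoint_union I L)"
    then show "p .=\<^bsub>disjoint_union I L\<^esub> q"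
      using assms by (cases p; cases q) (auto intro: partial_order.le_antisym)
  next
    fix p q r assume "p \<sqsubseteq>\<^bsub>disjoint_union I L\<^esub> q" "q \<sqsubseteq>\<^bsub>disjoint_union I L\<^esub> r"
      "p \<in> carrier (disjoint_union I L)" "q \<in> carrier (disjoint_union I L)"
      "r \<in> carrier (disjoint_union I L)"
    then show "p \<sqsubseteq>\<^bsub>disjoint_union I L\<^esub> r"
      using assms
      by (cases p; cases q; cases r) (auto intro: weak_partial_order.le_trans partial_order.axioms(1))
  qed auto
qed

text \<open>Comparable elements have the same index, so a descending sequence stays in one
  summand.\<close>

lemma well_founded_disjoint_union:
  assumes po: "\<And>i. i \<in> I \<Longrightarrow> partial_order (L i)" and wf: "\<And>i. i \<in> I \<Longrightarrow> well_founded (L i)"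
  shows "well_founded (disjoint_union I L)"
  unfolding well_founded_def
proof
  assume "\<exists>f. \<forall>n::nat. f n \<in> carrier (disjoint_union I L) \<and> f (Suc n) \<sqsubset>\<^bsub>disjoint_union I L\<^esub> f n"
  then obtain f :: "nat \<Rightarrow> 'a \<times> 'b" where f: "\<And>n. f n \<in> carrier (disjoint_union I L)"
    "\<And>n. f (Suc n) \<sqsubset>\<^bsub>disjoint_union I L\<^esub> f n" by blast
  have step: "fst (f (Suc n)) = fst (f n) \<and> snd (f (Suc n)) \<sqsubseteq>\<^bsub>L (fst (f n))\<^esub> snd (f n) \<and>
      snd (f (Suc n)) \<noteq> snd (f n)" for n
    using f(2)[of n] by (cases "f n"; cases "f (Suc n)") (auto simp: lless_def)
  have fst: "fst (f n) = fst (f 0)" for n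
    by (induction n) (use step in auto)
  have I: "fst (f 0) \<in> I" using f(1)[of 0] by auto
  have "snd (f n) \<in> carrier (L (fst (f 0)))" for n using f(1)[of n] fst[of n] by auto
  moreover have "snd (f (Suc n)) \<sqsubset>\<^bsub>L (fst (f 0))\<^esub> snd (f n)" for n
    using step[of n] fst[of n] by (simp add: lless_iff[OF po[OF I]])
  ultimately show False
    using wf[OF I] unfolding well_founded_def by (auto dest: spec[of _ "\<lambda>n. snd (f n)"])
qed

text \<open>A strict predecessor of \<open>x\<close> is also one of \<open>y\<close>. This keeps the
  joins and meets used below inside the reduced alphabet.\<close>

lemma remove_minimal_upward_closed:
  assumes "partial_order P" "x \<in> carrier (remove_minimal P)" "y \<in> carrier P" "x \<sqsubseteq>\<^bsub>P\<^esub> y"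
  shows "y \<in> carrier (remove_minimal P)"
proof -
  interpret partial_order P by fact
  obtain z where z: "z \<in> carrier P" "z \<sqsubset>\<^bsub>P\<^esub> x" "x \<in> carrier P"
    using assms(2) by (auto simp: minimal_elements_def)
  then have "z \<sqsubset>\<^bsub>P\<^esub> y"
    using assms lless_iff[OF assms(1)] by (metis lless_trans)
  then show ?thesis using z assms(3) by (auto simp: minimal_elements_def)
qed

lemma partial_order_remove_minimal:
  assumes "partial_order P" shows "partial_order (remove_minimal P)"
proof -
  interpret partial_order P by fact
  interpret R: weak_partial_order "remove_minimal P"
    unfolding remove_minimal_def using weak_partial_order_axioms
    by (rule weak_partial_order_subset) auto
  show ?thesis by unfold_locales (simp add: eq_is_equal)
qed

text \<open>Compatible letters lie in the same summand, where their join is a common upper bound and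
  their meet generates the common lower bounds.\<close>

lemma closed_sets_words_remove_minimal:
  assumes L: "\<And>i. i \<in> I \<Longrightarrow> Lattice.lattice (L i)" and wf: "\<And>i. i \<in> I \<Longrightarrow> well_founded (L i)"
  shows "closed_sets_are_wf_lattice_of_fin_gen (words (remove_minimal (disjoint_union I L)))"
proof -
  let ?U = "disjoint_union I L" and ?R = "remove_minimal (disjoint_union I L)"
  have po: "partial_order (L i)" if "i \<in> I" for i
    using L[OF that] by (simp add: Lattice.lattice_def upper_semilattice_def)
  have U: "partial_order ?U" using po by (rule partial_order_disjoint_union)
  have R: "partial_order ?R" using U by (rule partial_order_remove_minimal)
  show ?thesis
  proof (rule closed_sets_words_sufficient[OF R])
    have "well_founded ?U" using po wf by (rule well_founded_disjoint_union)
    then show "well_founded ?R" unfolding well_founded_def lless_def by auto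
  next
    fix p q assume pq: "p \<in> carrier ?R" "q \<in> carrier ?R" "compatible ?R p q"
    then obtain r where r: "r \<in> carrier ?R" "r \<sqsubseteq>\<^bsub>?R\<^esub> p" "r \<sqsubseteq>\<^bsub>?R\<^esub> q" by (auto simp: compatible_def)
    obtain i x y z where ixyz: "p = (i, x)" "q = (i, y)" "r = (i, z)"
      using r by (cases p; cases q; cases r) auto
    then have i: "i \<in> I" and car: "x \<in> carrier (L i)" "y \<in> carrier (L i)" "z \<in> carrier (L i)"
      and z: "z \<sqsubseteq>\<^bsub>L i\<^esub> x" "z \<sqsubseteq>\<^bsub>L i\<^esub> y"
      using pq r by auto
    interpret Li: Lattice.lattice "L i" using L[OF i] .
    obtain s where s: "s \<in> carrier (L i)" "x \<sqsubseteq>\<^bsub>L i\<^esub> s" "y \<sqsubseteq>\<^bsub>L i\<^esub> s"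
      using Li.join_left[OF car(1,2)] Li.join_right[OF car(1,2)] Li.join_closed[OF car(1,2)] by blast
    have "(i, s) \<in> carrier ?R"
      using remove_minimal_upward_closed[OF U pq(1), of "(i, s)"] s i ixyz by simp
    then show "\<exists>d\<in>carrier ?R. p \<sqsubseteq>\<^bsub>?R\<^esub> d \<and> q \<sqsubseteq>\<^bsub>?R\<^esub> d"
      using s ixyz by (intro bexI[of _ "(i, s)"]) auto
    let ?m = "x \<sqinter>\<^bsub>L i\<^esub> y"
    have m: "?m \<in> carrier (L i)" "?m \<sqsubseteq>\<^bsub>L i\<^esub> x" "?m \<sqsubseteq>\<^bsub>L i\<^esub> y"
      using car Li.meet_left Li.meet_right Li.meet_closed by auto
    \<comment> \<open>The meet is above \<open>z\<close>, a common lower bound that was not removed,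
      so the meet is not removed either.\<close>
    have "z \<sqsubseteq>\<^bsub>L i\<^esub> ?m" using z car Li.meet_le by blast
    then have mR: "(i, ?m) \<in> carrier ?R"
      using remove_minimal_upward_closed[OF U r(1), of "(i, ?m)"] m i ixyz by simp
    have "{c \<in> carrier ?R. c \<sqsubseteq>\<^bsub>?R\<^esub> p \<and> c \<sqsubseteq>\<^bsub>?R\<^esub> q} = down ?R {(i, ?m)}"
    proof (intro equalityI subsetI)
      fix c assume "c \<in> {c \<in> carrier ?R. c \<sqsubseteq>\<^bsub>?R\<^esub> p \<and> c \<sqsubseteq>\<^bsub>?R\<^esub> q}"
      then show "c \<in> down ?R {(i, ?m)}"
        using ixyz car Li.meet_le by (cases c) (auto simp: down_def)
    next
      fix c assume c: "c \<in> down ?R {(i, ?m)}"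
      then obtain v where v: "c = (i, v)" "v \<in> carrier (L i)" "v \<sqsubseteq>\<^bsub>L i\<^esub> ?m"
        by (cases c) (auto simp: down_def)
      then have "v \<sqsubseteq>\<^bsub>L i\<^esub> x" "v \<sqsubseteq>\<^bsub>L i\<^esub> y" using m car Li.le_trans by blast+
      then show "c \<in> {c \<in> carrier ?R. c \<sqsubseteq>\<^bsub>?R\<^esub> p \<and> c \<sqsubseteq>\<^bsub>?R\<^esub> q}"
        using c v ixyz by (simp add: down_def)
    qed
    then show "fin_gen_lower_set ?R {c \<in> carrier ?R. c \<sqsubseteq>\<^bsub>?R\<^esub> p \<and> c \<sqsubseteq>\<^bsub>?R\<^esub> q}"
      using mR by (intro fin_gen_lower_setI[of "{(i, ?m)}"]) auto
  qed
qed

theorem theorem3p4: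
  fixes \<Lambda> :: "'a gorder" and I :: "'i set" and L :: "'i \<Rightarrow> 'b gorder"
  shows "(partial_order \<Lambda> \<longrightarrow>
      (closed_sets_are_wf_lattice_of_fin_gen (words \<Lambda>) \<longleftrightarrow>
        well_founded \<Lambda> \<and>
        (\<forall>\<alpha>\<in>carrier \<Lambda>. \<forall>\<beta>\<in>carrier \<Lambda>.
          compatible \<Lambda> \<alpha> \<beta> \<and> incomparable \<Lambda> \<alpha> \<beta> \<longrightarrow>
            (\<exists>\<gamma>\<in>carrier \<Lambda>. \<alpha> \<sqsubseteq>\<^bsub>\<Lambda>\<^esub> \<gamma> \<and> \<beta> \<sqsubseteq>\<^bsub>\<Lambda>\<^esub> \<gamma>) \<and>
            fin_gen_lower_set \<Lambda> {\<gamma>\<in>carrier \<Lambda>. \<gamma> \<sqsubseteq>\<^bsub>\<Lambda>\<^esub> \<alpha> \<and> \<gamma> \<sqsubseteq>\<^bsub>\<Lambda>\<^esub> \<beta>})))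
    \<and> ((\<forall>i\<in>I. Lattice.lattice (L i) \<and> well_founded (L i)) \<longrightarrow>
        partial_order (remove_minimal (disjoint_union I L)) \<and>
        closed_sets_are_wf_lattice_of_fin_gen (words (remove_minimal (disjoint_union I L))))"
  (is "(_ \<longrightarrow> (?C \<longleftrightarrow> ?wf \<and> ?pairs)) \<and> (?lattices \<longrightarrow> _)")
proof (intro conjI impI iffI)
  assume P: "partial_order \<Lambda>" and C: ?C
  show ?wf by (rule closed_sets_words_necessary(1)[OF P C])
  show ?pairs
    using closed_sets_words_necessary(2,3)[OF P C] by blast
next
  assume P: "partial_order \<Lambda>" and R: "?wf \<and> ?pairs"
  then show ?C by (intro closed_sets_words_sufficient) blast+
next
  assume L: ?lattices
  then have "partial_order (L i)" if "i \<in> I" for i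
    using that by (simp add: Lattice.lattice_def upper_semilattice_def)
  then show "partial_order (remove_minimal (disjoint_union I L))"
    by (intro partial_order_remove_minimal partial_order_disjoint_union)
  show "closed_sets_are_wf_lattice_of_fin_gen (words (remove_minimal (disjoint_union I L)))"
    using L by (intro closed_sets_words_remove_minimal) auto
qed

end
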